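(* If $f(z)=z+\sum_{n=2}^{\infty}a_nz^n\in \mathcal{S}_{S,e}^*$, then $$|H_{2,3}(f^{-1})|=|A_3A_5-A_4^2|\leq\frac{1}{4}.$$ The inequality is sharp.
   Context: $\mathbb{D}=\{z\in\mathbb{C}:|z|<1\}$. $\mathcal{S}$ is the class of univalent (injective) analytic functions $f$ on $\mathbb{D}$ with expansion $f(z)=z+\sum_{n\ge 2}a_nz^n$. For analytic $g,h$ on $\mathbb{D}$, $g\prec h$ (subordination) means $g=h\circ w$ for some analytic $w:\mathbb{D}\to\mathbb{D}$ with $w(0)=0$. The class is $$\mathcal{S}_{S,e}^*=\left\{f\in\mathcal{S}:\ \frac{2zf'(z)}{f(z)-f(-z)}\prec e^z\right\}.$$ For $f\in\mathcal{S}$, the inverse function near $0$ is $f^{-1}(w)=w+A_2w^2+A_3w^3+A_4w^4+A_5w^5+\cdots$, and $H_{2,3}(f^{-1}):=A_3A_5-A_4^2$. "Sharp" means that equality is attained by some function in the class. *)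

theory Defs
  imports "HOL-Complex_Analysis.Complex_Analysis"
begin

abbreviation unit_disc :: "complex set" where
  "unit_disc \<equiv> ball 0 1"

definition schlicht_class :: "(complex \<Rightarrow> complex) set" where
  "schlicht_class =
     {f. f holomorphic_on unit_disc \<and> inj_on f unit_disc \<and> f 0 = 0 \<and> deriv f 0 = 1}"

definition subordinate :: "(complex \<Rightarrow> complex) \<Rightarrow> (complex \<Rightarrow> complex) \<Rightarrow> bool"
    (infix "\<prec>\<^sub>D" 50) where
  "g \<prec>\<^sub>D h \<longleftrightarrow> g holomorphic_on unit_disc \<and> h holomorphic_on unit_disc \<and>
     (\<exists>w. w holomorphic_on unit_disc \<and> w ` unit_disc \<subseteq> unit_disc \<and> w 0 = 0 \<and>
          (\<forall>z\<in>unit_disc. g z = h (w z)))"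

text \<open>
  The quotient $2 z f'(z) / (f(z) - f(-z))$ has a removable singularity at 0, where division
  in HOL would yield 0. It is completed by its limit, which is 1 for every normalised function
  (lemma \<open>sym_quotient_tendsto\<close>).
\<close>

definition sym_quotient :: "(complex \<Rightarrow> complex) \<Rightarrow> complex \<Rightarrow> complex" where
  "sym_quotient f z = (if z = 0 then 1 else 2 * z * deriv f z / (f z - f (- z)))"

definition S_star_Se :: "(complex \<Rightarrow> complex) set" where
  "S_star_Se = {f \<in> schlicht_class. sym_quotient f \<prec>\<^sub>D exp}"

text \<open>
  Values of \<^term>\<open>f\<close> outside the disc are irrelevant, so the inverse is taken on the disc;
  on the open image of the disc, a neighbourhood of 0, it is holomorphic.
\<close>

definition inverse_coeff :: "(complex \<Rightarrow> complex) \<Rightarrow> nat \<Rightarrow> complex" where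
  "inverse_coeff f n = fps_nth (fps_expansion (inv_into unit_disc f) 0) n"

definition H23_inverse :: "(complex \<Rightarrow> complex) \<Rightarrow> complex" where
  "H23_inverse f = inverse_coeff f 3 * inverse_coeff f 5 - (inverse_coeff f 4)\<^sup>2"

lemma sym_quotient_tendsto:
  assumes "f \<in> schlicht_class"
  shows "(\<lambda>z. 2 * z * deriv f z / (f z - f (- z))) \<midarrow>0\<rightarrow> 1"
proof -
  have hol: "f holomorphic_on unit_disc" and f0: "f 0 = 0" and d0: "deriv f 0 = 1"
    using assms by (auto simp: schlicht_class_def)
  have "(f has_field_derivative 1) (at 0)"
    using holomorphic_derivI[OF hol open_ball, of 0] d0 by simp
  then have q: "(\<lambda>z. f z / z) \<midarrow>0\<rightarrow> 1"
    by (simp add: has_field_derivative_iff f0)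
  have "filterlim (\<lambda>z::complex. - z) (at 0) (at 0)"
    using filterlim_at_within_not_equal[of "\<lambda>z::complex. - z" 0 UNIV "at 0" 0]
    by (auto simp: filterlim_at eventually_at_filter intro!: tendsto_eq_intros)
  from filterlim_compose[OF q this] have q': "(\<lambda>z. f (- z) / (- z)) \<midarrow>0\<rightarrow> 1" .
  have "isCont (deriv f) 0"
    using holomorphic_deriv[OF hol open_ball] holomorphic_on_imp_continuous_on
      continuous_on_interior[of unit_disc "deriv f" 0] by fastforce
  then have "deriv f \<midarrow>0\<rightarrow> 1"
    by (simp add: isCont_def d0)
  with q q' have "(\<lambda>z. 2 * deriv f z / (f z / z + f (- z) / (- z))) \<midarrow>0\<rightarrow> 2 * 1 / (1 + 1)"
    by (intro tendsto_intros) auto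
  moreover have "\<forall>\<^sub>F z in at 0. 2 * deriv f z / (f z / z + f (- z) / (- z))
      = 2 * z * deriv f z / (f z - f (- z))"
  proof (rule eventually_mono[OF eventually_neq_at_within[of 0]])
    fix z :: complex
    assume "z \<noteq> 0"
    then have "f z / z + f (- z) / (- z) = (f z - f (- z)) / z"
      by (simp add: field_simps)
    then show "2 * deriv f z / (f z / z + f (- z) / (- z))
      = 2 * z * deriv f z / (f z - f (- z))"
      by simp
  qed
  ultimately show ?thesis
    using tendsto_cong by fastforce
qed

end

theory Submission
  imports Defs
begin

text \<open>
  Writing the defining subordination as \<open>2 z f'(z) = (f(z) - f(-z)) exp (w(z))\<close> with a Schwarz
  function \<open>w(z) = c\<^sub>1 z + c\<^sub>2 z^2 + \<dots>\<close>, comparison of coefficients turns the Hankel determinant into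
  a polynomial in \<open>c\<^sub>1, \<dots>, c\<^sub>4\<close>. Multiplication by \<open>w\<close> is a contraction of the Hardy space, and
  testing it on suitable polynomials yields \<open>\<bar>c\<^sub>2\<bar> \<le> 1 - \<bar>c\<^sub>1\<bar>^2\<close>,
  \<open>\<bar>c\<^sub>3\<bar>^2 \<le> 1 - \<bar>c\<^sub>1\<bar>^2 - \<bar>c\<^sub>2\<bar>^2\<close> and \<open>\<bar>c\<^sub>4\<bar> \<le> 1 - \<bar>c\<^sub>1\<bar>^2 - \<bar>c\<^sub>2\<bar>^2\<close>. With these the triangle
  inequality, applied term by term, already gives the bound \<open>1/4\<close>.

  Equality forces \<open>w(z) = z^2\<close> up to rotation, that is \<open>f(z) = z exp (E (z^2))\<close> with
  \<open>2 u E'(u) = e^u - 1\<close>. Then \<open>f'(z) = exp (z^2 + E (z^2))\<close>, and since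
  \<open>\<bar>Im (u + E u)\<bar> < \<pi>/2\<close> on the disc, \<open>f'\<close> has positive real part and \<open>f\<close> is univalent.
\<close>

section \<open>Mean values over circles and Parseval's identity\<close>

text \<open>On the circle of radius \<open>r\<close> the conjugate of \<open>c\<close> is
  \<open>r^2 / c\<close>, so the integrand equals \<open>r ^ (2 * k)\<close> times
  \<open>h c / c ^ k\<close>, and Cauchy's formula for the k-th Taylor coefficient applies. The
  parameter runs over \<open>{0..1}\<close>, so these integrals are mean values.\<close>

lemma has_integral_circle_cnj_power:
  fixes h :: "complex \<Rightarrow> complex"
  assumes h: "h holomorphic_on ball 0 1" "h has_fps_expansion H" and r: "0 < r" "r < 1"
  shows "((\<lambda>t. h (circlepath 0 r t) * cnj (circlepath 0 r t) ^ k) has_integral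
           fps_nth H k * of_real (r ^ (2 * k))) {0..1}"
proof -
  have "cball 0 r \<subseteq> ball (0::complex) 1"
    using r by auto
  then have "continuous_on (cball 0 r) h" "h holomorphic_on ball 0 r"
    using h(1) r by (auto intro: holomorphic_on_subset holomorphic_on_imp_continuous_on)
  then have "((\<lambda>u. h u / (u - 0) ^ Suc k) has_contour_integral
      2 * pi * \<i> / fact k * (deriv ^^ k) h 0) (circlepath 0 r)"
    by (rule Cauchy_has_contour_integral_higher_derivative_circlepath) (use r in auto)
  then have "((\<lambda>t. h (circlepath 0 r t) / circlepath 0 r t ^ Suc k *
      vector_derivative (circlepath 0 r) (at t within {0..1})) has_integral
      2 * pi * \<i> * fps_nth H k) {0..1}"
    by (simp add: has_contour_integral_def fps_nth_fps_expansion[OF h(2)])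
  then have "((\<lambda>t. of_real (r ^ (2 * k)) / (2 * pi * \<i>) *
      (h (circlepath 0 r t) / circlepath 0 r t ^ Suc k *
      vector_derivative (circlepath 0 r) (at t within {0..1}))) has_integral
      of_real (r ^ (2 * k)) / (2 * pi * \<i>) * (2 * pi * \<i> * fps_nth H k)) {0..1}"
    by (rule has_integral_mult_right)
  then have "((\<lambda>t. of_real (r ^ (2 * k)) / (2 * pi * \<i>) *
      (h (circlepath 0 r t) / circlepath 0 r t ^ Suc k *
      vector_derivative (circlepath 0 r) (at t within {0..1}))) has_integral
      fps_nth H k * of_real (r ^ (2 * k))) {0..1}"
    by (simp add: mult.commute)
  then show ?thesis
  proof (rule has_integral_eq[rotated])
    fix t :: real
    assume t: "t \<in> {0..1}"
    define c where "c = circlepath 0 r t"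
    have d: "vector_derivative (circlepath 0 r) (at t within {0..1}) = 2 * pi * \<i> * c"
      using vector_derivative_circlepath01[of t 0 r] t by (simp add: c_def) (simp add: circlepath mult_ac)
    have "norm c = r"
      using r by (simp add: c_def circlepath norm_mult)
    then have n: "c * cnj c = of_real (r ^ 2)" and "c \<noteq> 0"
      using r by (auto simp: complex_norm_square[symmetric])
    have "of_real (r ^ (2 * k)) = c ^ k * cnj c ^ k"
      by (simp add: power_mult flip: n power_mult_distrib) (metis n of_real_power)
    with \<open>c \<noteq> 0\<close> show "of_real (r ^ (2 * k)) / (2 * pi * \<i>) *
        (h (circlepath 0 r t) / circlepath 0 r t ^ Suc k *
        vector_derivative (circlepath 0 r) (at t within {0..1}))
        = h (circlepath 0 r t) * cnj (circlepath 0 r t) ^ k"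
      unfolding d c_def[symmetric] by (simp add: field_simps)
  qed
qed

lemma has_integral_circle_cnj_polynomial:
  fixes h :: "complex \<Rightarrow> complex"
  assumes h: "h holomorphic_on ball 0 1" "h has_fps_expansion H" and r: "0 < r" "r < 1"
  shows "((\<lambda>t. h (circlepath 0 r t) * cnj (\<Sum>k\<le>n. q k * circlepath 0 r t ^ k)) has_integral
           (\<Sum>k\<le>n. cnj (q k) * (fps_nth H k * of_real (r ^ (2 * k))))) {0..1}"
proof -
  have "((\<lambda>t. \<Sum>k\<le>n. cnj (q k) * (h (circlepath 0 r t) * cnj (circlepath 0 r t) ^ k)) has_integral
           (\<Sum>k\<le>n. cnj (q k) * (fps_nth H k * of_real (r ^ (2 * k))))) {0..1}"
    by (intro has_integral_sum has_integral_mult_right has_integral_circle_cnj_power assms) auto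
  then show ?thesis
    by (simp add: sum_distrib_left mult_ac)
qed

text \<open>Parseval's identity, obtained by pairing the polynomial with itself in the preceding
  lemma.\<close>

lemma has_integral_circle_norm_polynomial:
  fixes q :: "nat \<Rightarrow> complex"
  assumes r: "0 < r" "r < 1"
  shows "((\<lambda>t. (norm (\<Sum>k\<le>n. q k * circlepath 0 r t ^ k))\<^sup>2) has_integral
           (\<Sum>k\<le>n. (norm (q k))\<^sup>2 * r ^ (2 * k))) {0..1}"
proof -
  define Q where "Q = (\<Sum>k\<le>n. fps_const (q k) * fps_X ^ k)"
  have "(\<lambda>z. \<Sum>k\<le>n. q k * z ^ k) has_fps_expansion Q"
    unfolding Q_def by (intro fps_expansion_intros)
  then have "((\<lambda>t. (\<Sum>k\<le>n. q k * circlepath 0 r t ^ k) *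
      cnj (\<Sum>k\<le>n. q k * circlepath 0 r t ^ k)) has_integral
      (\<Sum>k\<le>n. cnj (q k) * (fps_nth Q k * of_real (r ^ (2 * k))))) {0..1}"
    by (intro has_integral_circle_cnj_polynomial holomorphic_intros r)
  moreover have "fps_nth Q k = q k" if "k \<le> n" for k
    using that by (simp add: Q_def fps_sum_nth if_distrib sum.delta cong: if_cong)
  ultimately have "((\<lambda>t. complex_of_real ((norm (\<Sum>k\<le>n. q k * circlepath 0 r t ^ k))\<^sup>2))
      has_integral (\<Sum>k\<le>n. of_real ((norm (q k))\<^sup>2 * r ^ (2 * k)))) {0..1}"
    by (simp add: complex_norm_square mult_ac del: of_real_power cnj_sum)
  from has_integral_Re[OF this] show ?thesis
    by (simp del: of_real_power)
qed

text \<open>Let \<open>q\<close> be the Taylor polynomial of \<open>g\<close> of degree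
  \<open>n\<close>, and \<open>S\<close> the mean of \<open>|q|^2\<close> on a circle of radius
  \<open>r < 1\<close>. The mean of \<open>2 Re (g cnj q)\<close> is \<open>2 S\<close>, while
  pointwise it is at most \<open>|g|^2 + |q|^2\<close>, hence at most \<open>|p|^2 + |q|^2\<close>.
  Cancelling one \<open>S\<close> gives the claim with weights \<open>r ^ (2 * k)\<close>, which
  disappear as \<open>r\<close> tends to 1.\<close>

lemma sum_norm_fps_nth_le:
  fixes g :: "complex \<Rightarrow> complex"
  assumes g: "g holomorphic_on ball 0 1" "g has_fps_expansion G"
    and le: "\<And>z. norm z < 1 \<Longrightarrow> norm (g z) \<le> norm (\<Sum>k\<le>n. p k * z ^ k)"
  shows "(\<Sum>k\<le>n. (norm (fps_nth G k))\<^sup>2) \<le> (\<Sum>k\<le>n. (norm (p k))\<^sup>2)"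
proof -
  have main: "(\<Sum>k\<le>n. (norm (fps_nth G k))\<^sup>2 * r ^ (2 * k)) \<le> (\<Sum>k\<le>n. (norm (p k))\<^sup>2 * r ^ (2 * k))"
    if r: "0 < r" "r < 1" for r :: real
  proof -
    let ?c = "circlepath 0 r" and ?q = "\<lambda>z. \<Sum>k\<le>n. fps_nth G k * z ^ k"
    let ?S = "\<Sum>k\<le>n. (norm (fps_nth G k))\<^sup>2 * r ^ (2 * k)"
    have "((\<lambda>t. g (?c t) * cnj (?q (?c t))) has_integral
        (\<Sum>k\<le>n. of_real ((norm (fps_nth G k))\<^sup>2 * r ^ (2 * k)))) {0..1}"
      using has_integral_circle_cnj_polynomial[OF g r, of "fps_nth G" n]
      by (simp add: complex_norm_square mult_ac del: of_real_power cnj_sum)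
    from has_integral_Re[OF this]
    have "((\<lambda>t. 2 * Re (g (?c t) * cnj (?q (?c t)))) has_integral 2 * ?S) {0..1}"
      by (intro has_integral_mult_right) (simp del: of_real_power)
    moreover have "((\<lambda>t. (norm (\<Sum>k\<le>n. p k * ?c t ^ k))\<^sup>2 + (norm (?q (?c t)))\<^sup>2) has_integral
        (\<Sum>k\<le>n. (norm (p k))\<^sup>2 * r ^ (2 * k)) + ?S) {0..1}"
      by (intro has_integral_add has_integral_circle_norm_polynomial r)
    ultimately have "2 * ?S \<le> (\<Sum>k\<le>n. (norm (p k))\<^sup>2 * r ^ (2 * k)) + ?S"
    proof (rule has_integral_le)
      fix t :: real
      have "norm (?c t) < 1"
        using r by (simp add: circlepath norm_mult)
      from le[OF this] have "(norm (g (?c t)))\<^sup>2 \<le> (norm (\<Sum>k\<le>n. p k * ?c t ^ k))\<^sup>2"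
        by (intro power_mono) auto
      moreover have "2 * Re (a * cnj b) \<le> (norm a)\<^sup>2 + (norm b)\<^sup>2" for a b
        using sum_squares_ge_zero[of "Re a - Re b" "Im a - Im b"] unfolding cmod_power2
        by (simp add: power2_eq_square algebra_simps)
      ultimately show "2 * Re (g (?c t) * cnj (?q (?c t)))
          \<le> (norm (\<Sum>k\<le>n. p k * ?c t ^ k))\<^sup>2 + (norm (?q (?c t)))\<^sup>2"
        by (meson add_right_mono order_trans)
    qed
    then show ?thesis by simp
  qed
  have lim: "((\<lambda>r. \<Sum>k\<le>n. a k * r ^ (2 * k)) \<longlongrightarrow> (\<Sum>k\<le>n. a k * 1 ^ (2 * k))) (at_left 1)"
    for a :: "nat \<Rightarrow> real"
    by (intro tendsto_intros)
  have "\<forall>\<^sub>F r in at_left (1::real). 0 < r \<and> r < 1"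
    using eventually_at_left_real[of 0 "1::real"] by (auto elim: eventually_mono)
  then have "\<forall>\<^sub>F r in at_left 1. (\<Sum>k\<le>n. (norm (fps_nth G k))\<^sup>2 * r ^ (2 * k))
      \<le> (\<Sum>k\<le>n. (norm (p k))\<^sup>2 * r ^ (2 * k))"
    by eventually_elim (use main in auto)
  from tendsto_le[OF trivial_limit_at_left_real lim lim this] show ?thesis
    by simp
qed

section \<open>Coefficient inequalities for Schwarz functions\<close>

text \<open>The inner sums are the coefficients of \<open>w\<close> times the polynomial with
  coefficients \<open>p\<close>, a product dominated pointwise by that polynomial. Equivalently, the
  lower triangular Toeplitz matrix of \<open>W\<close> is a contraction.\<close>

lemma toeplitz_contraction:
  fixes w :: "complex \<Rightarrow> complex"
  assumes w: "w holomorphic_on ball 0 1" "w has_fps_expansion W"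
    and le: "\<And>z. norm z < 1 \<Longrightarrow> norm (w z) \<le> 1"
  shows "(\<Sum>k\<le>n. (norm (\<Sum>i\<le>k. fps_nth W i * p (k - i)))\<^sup>2) \<le> (\<Sum>k\<le>n. (norm (p k))\<^sup>2)"
proof -
  define P where "P = (\<Sum>k\<le>n. fps_const (p k) * fps_X ^ k)"
  have P: "fps_nth P k = p k" if "k \<le> n" for k
    using that by (simp add: P_def fps_sum_nth if_distrib sum.delta cong: if_cong)
  have "(\<lambda>z. w z * (\<Sum>k\<le>n. p k * z ^ k)) has_fps_expansion W * P"
    unfolding P_def by (intro fps_expansion_intros w)
  then have "(\<Sum>k\<le>n. (norm (fps_nth (W * P) k))\<^sup>2) \<le> (\<Sum>k\<le>n. (norm (p k))\<^sup>2)"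
    by (rule sum_norm_fps_nth_le[rotated])
       (auto intro!: holomorphic_intros w(1) mult_left_le_one_le le simp: norm_mult)
  moreover have "fps_nth (W * P) k = (\<Sum>i\<le>k. fps_nth W i * p (k - i))" if "k \<le> n" for k
    using that by (auto simp: fps_mult_nth atLeast0AtMost P intro!: sum.cong)
  ultimately show ?thesis by simp
qed

lemma exists_unimodular_mult_eq_norm:
  fixes c :: complex
  obtains l where "norm l = 1" "c * l = of_real (norm c)"
proof (cases "c = 0")
  case False
  show ?thesis
  proof
    show "norm (cnj (sgn c)) = 1" using False by (simp add: norm_sgn)
    show "c * cnj (sgn c) = of_real (norm c)"
      using False by (simp add: sgn_eq mult.commute complex_norm_square[symmetric] power2_eq_square)
  qed
qed (use that[of 1] in auto)

text \<open>The constant test polynomial 1 gives the second inequality. For the other two,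
  \<open>p\<close> is chosen so that the top coefficient of the product has the claimed left-hand
  side as its modulus, while lower coefficients reproduce the norms of the non-constant part of
  \<open>p\<close> and cancel. The unimodular \<open>l\<close> rotates the leading summand onto the
  nonnegative real axis.\<close>

lemma bounded_fps_nth_ineqs:
  fixes w :: "complex \<Rightarrow> complex"
  assumes w: "w holomorphic_on ball 0 1" "w has_fps_expansion W" "fps_nth W 0 = 0"
    and le: "\<And>z. norm z < 1 \<Longrightarrow> norm (w z) \<le> 1"
  defines "t \<equiv> norm (fps_nth W 1)" and "s \<equiv> norm (fps_nth W 2)"
    and "u \<equiv> norm (fps_nth W 3)" and "v \<equiv> norm (fps_nth W 4)"
  shows "s + t\<^sup>2 \<le> 1" "t\<^sup>2 + s\<^sup>2 + u\<^sup>2 \<le> 1" "v + t\<^sup>2 + s\<^sup>2 \<le> 1"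
proof -
  note contr = toeplitz_contraction[OF w(1,2) le]
  note nat_simps = numeral_eq_Suc
  let ?c = "fps_nth W"
  show "t\<^sup>2 + s\<^sup>2 + u\<^sup>2 \<le> 1"
    using contr[where n = 3 and p = "\<lambda>k. if k = 0 then 1 else 0"] w(3)
    by (simp add: t_def s_def u_def nat_simps)
  txt \<open>Test polynomial \<open>l + cnj c\<^sub>1 z\<close>.\<close>
  obtain l where l: "norm l = 1" "?c 2 * l = of_real s"
    using exists_unimodular_mult_eq_norm s_def by metis
  have "?c 2 * l + ?c 1 * cnj (?c 1) = of_real (s + t\<^sup>2)"
    using l(2) by (simp add: t_def flip: complex_norm_square)
  then have "norm (?c 2 * l + ?c 1 * cnj (?c 1)) = s + t\<^sup>2"
    by (simp only: norm_of_real) (simp add: s_def)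
  \<comment> \<open>The term \<open>t\<^sup>2\<close> on the left is the coefficient
    \<open>c\<^sub>1 l\<close> of \<open>z\<close>; on the right it comes from
    \<open>cnj c\<^sub>1\<close> in \<open>p\<close>.\<close>
  then have "t\<^sup>2 + (s + t\<^sup>2)\<^sup>2 \<le> 1 + t\<^sup>2"
    using contr[where n = 2 and p = "\<lambda>k. if k = 0 then l else if k = 1 then cnj (?c 1) else 0"] w(3) l(1)
    by (simp add: t_def nat_simps norm_mult add_ac)
  then have "(s + t\<^sup>2)\<^sup>2 \<le> 1\<^sup>2" by simp
  then show "s + t\<^sup>2 \<le> 1" by (rule power2_le_imp_le) simp
  txt \<open>Test polynomial \<open>l + cnj c\<^sub>2 z^2 + cnj c\<^sub>1 z^3\<close>.\<close>
  obtain l where l: "norm l = 1" "?c 4 * l = of_real v"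
    using exists_unimodular_mult_eq_norm v_def by metis
  have "?c 4 * l + (?c 2 * cnj (?c 2) + ?c 1 * cnj (?c 1)) = of_real (v + t\<^sup>2 + s\<^sup>2)"
    using l(2) by (simp add: t_def s_def flip: complex_norm_square)
  then have "norm (?c 4 * l + (?c 2 * cnj (?c 2) + ?c 1 * cnj (?c 1))) = v + t\<^sup>2 + s\<^sup>2"
    by (simp only: norm_of_real) (simp add: v_def)
  then have n: "norm (?c 1 * cnj (?c 1) + (?c 2 * cnj (?c 2) + ?c 4 * l)) = v + t\<^sup>2 + s\<^sup>2"
    by (simp add: add_ac)
  \<comment> \<open>The coefficients of \<open>z\<close> and \<open>z^2\<close> have moduli
    \<open>t\<close> and \<open>s\<close>; that of \<open>z^3\<close> is discarded.\<close>
  have "t\<^sup>2 + s\<^sup>2 + (v + t\<^sup>2 + s\<^sup>2)\<^sup>2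
      \<le> t\<^sup>2 + s\<^sup>2 + (norm (?c 3 * l + ?c 1 * cnj (?c 2)))\<^sup>2 + (v + t\<^sup>2 + s\<^sup>2)\<^sup>2"
    by simp
  also have "\<dots> \<le> 1 + s\<^sup>2 + t\<^sup>2"
    using contr[where n = 4 and p = "\<lambda>k. if k = 0 then l else if k = 2 then cnj (?c 2)
        else if k = 3 then cnj (?c 1) else 0"] w(3) l(1) n
    by (simp add: t_def s_def nat_simps norm_mult add_ac)
  finally have "(v + t\<^sup>2 + s\<^sup>2)\<^sup>2 \<le> 1\<^sup>2" by simp
  then show "v + t\<^sup>2 + s\<^sup>2 \<le> 1" by (rule power2_le_imp_le) simp
qed

section \<open>The real inequality behind the constant 1/4\<close>

text \<open>First \<open>u\<close> and \<open>v\<close> are eliminated, which leaves a polynomial in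
  \<open>s\<close> and \<open>T = t^2\<close> that is quadratic in \<open>T\<close>. The constraint
  \<open>T \<le> 1 - s\<close> then removes \<open>T\<close>, and the remaining cubic in
  \<open>s\<close> reaches 1/4 only at \<open>s = 1\<close>.\<close>

lemma hankel_majorant_le:
  fixes t s u v :: real
  assumes nn: "0 \<le> t" "0 \<le> s" "0 \<le> u" "0 \<le> v"
    and st: "s + t\<^sup>2 \<le> 1" and stu: "t\<^sup>2 + s\<^sup>2 + u\<^sup>2 \<le> 1" and stv: "v + t\<^sup>2 + s\<^sup>2 \<le> 1"
  shows "13/2304 * t^6 + 5/64 * (t^4 * s) + 7/96 * (t^3 * u) + 9/64 * (t\<^sup>2 * s\<^sup>2) + 1/16 * (t\<^sup>2 * v)
      + 3/16 * (t * s * u) + 1/4 * s^3 + 1/8 * (s * v) + 1/16 * u\<^sup>2 \<le> 1/4" (is "?L \<le> _")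
proof -
  define T where "T = t\<^sup>2"
  have T: "0 \<le> T" "T \<le> 1 - s" "T \<le> 1" "s \<le> 1"
    using st nn by (auto simp: T_def intro: order_trans[rotated])
  have vT: "v \<le> 1 - T - s\<^sup>2"
    using stv by (simp add: T_def)
  \<comment> \<open>From \<open>2 t u \<le> t^2 + u^2\<close> and the second constraint.\<close>
  have tu: "t * u \<le> (1 - s\<^sup>2) / 2"
    using stu sum_squares_ge_zero[of "t - u" 0] by (simp add: power2_eq_square algebra_simps)
  have "t^3 * u \<le> T * ((1 - s\<^sup>2) / 2)"
    using mult_left_mono[OF tu T(1)] by (simp add: T_def power2_eq_square power3_eq_cube mult_ac)
  moreover have "t * s * u \<le> s * ((1 - s\<^sup>2) / 2)"
    using mult_left_mono[OF tu nn(2)] by (simp add: mult_ac)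
  moreover have "t\<^sup>2 * v \<le> T * (1 - T - s\<^sup>2)" "s * v \<le> s * (1 - T - s\<^sup>2)"
    using vT nn T(1) by (auto intro!: mult_left_mono simp flip: T_def)
  moreover have "u\<^sup>2 \<le> 1 - T - s\<^sup>2"
    using stu by (simp add: T_def)
  moreover have "t^6 \<le> T\<^sup>2"
    using power_decreasing[of 2 3 T] T by (simp add: T_def flip: power_mult)
  moreover have "t^4 * s = T\<^sup>2 * s"
    by (simp add: T_def flip: power_mult)
  ultimately have "?L \<le> 13/2304 * T\<^sup>2 + 5/64 * (T\<^sup>2 * s) + 7/96 * (T * ((1 - s\<^sup>2) / 2))
      + 9/64 * (T * s\<^sup>2) + 1/16 * (T * (1 - T - s\<^sup>2)) + 3/16 * (s * ((1 - s\<^sup>2) / 2))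
      + 1/4 * s^3 + 1/8 * (s * (1 - T - s\<^sup>2)) + 1/16 * (1 - T - s\<^sup>2)"
    unfolding T_def[symmetric] using T nn vT
    by (intro add_mono mult_left_mono) auto
  also have "\<dots> = (7 - 24 * s + 8 * s\<^sup>2) / 192 * T - (131/2304 - 5/64 * s) * T\<^sup>2
      + 7/32 * (s * (1 - s\<^sup>2)) + 1/4 * s^3 + 1/16 * (1 - s\<^sup>2)"
    by (simp add: power2_eq_square power3_eq_cube field_simps)
  also have "\<dots> \<le> 7/192 * (1 - s) + 7/32 * (s * (1 - s\<^sup>2)) + 1/4 * s^3 + 1/16 * (1 - s\<^sup>2)"
  proof -
    have "s * T\<^sup>2 \<le> s * ((1 - s) * T)"
      using T nn by (intro mult_left_mono) (auto simp: power2_eq_square intro!: mult_right_mono)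
    then have "s * T\<^sup>2 \<le> s * T - s\<^sup>2 * T"
      by (simp add: power2_eq_square algebra_simps)
    moreover have "0 \<le> s * T" "0 \<le> s\<^sup>2 * T" "0 \<le> T\<^sup>2"
      using T nn by auto
    \<comment> \<open>The monomials \<open>s T\<close>, \<open>s^2 T\<close>, \<open>T^2\<close> and
      \<open>s T^2\<close> are abstracted to \<open>x\<close>, \<open>y\<close>, \<open>z\<close>
      and \<open>a\<close>, which makes the claim linear. Substituting the bound for
      \<open>a\<close> leaves \<open>-9/192 x - 7/192 y\<close> beside
      \<open>7/192 T\<close>.\<close>
    moreover have "7/192 * T - 24/192 * x + 8/192 * y - (131/2304 * z - 5/64 * a) \<le> 7/192 * (1 - s)"
      if "a \<le> x - y" "0 \<le> x" "0 \<le> y" "0 \<le> z" for a x y z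
      using that T(2) by argo
    ultimately have "7/192 * T - 24/192 * (s * T) + 8/192 * (s\<^sup>2 * T)
        - (131/2304 * T\<^sup>2 - 5/64 * (s * T\<^sup>2)) \<le> 7/192 * (1 - s)"
      by blast
    then have "(7 - 24 * s + 8 * s\<^sup>2) / 192 * T - (131/2304 - 5/64 * s) * T\<^sup>2 \<le> 7/192 * (1 - s)"
      by (simp add: field_simps)
    then show ?thesis
      by (intro add_right_mono)
  qed
  \<comment> \<open>The quadratic factor is positive on the unit interval because
    \<open>s \<le> 1\<close>.\<close>
  also have "\<dots> = 1/4 - (1 - s) * (29 - 6 * s + 6 * s\<^sup>2) / 192"
    by (simp add: power2_eq_square power3_eq_cube field_simps)
  also have "\<dots> \<le> 1/4"
    using T nn by (auto intro!: mult_nonneg_nonneg add_nonneg_nonneg)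
  finally show ?thesis .
qed

section \<open>The Hankel determinant as a polynomial in the Schwarz coefficients\<close>

text \<open>Since \<open>F ^ i\<close> begins with the i-th power of the variable with coefficient
  1, comparing coefficients in \<open>G oo F = fps_X\<close> gives a unitriangular system, solved
  successively for the coefficients of \<open>G\<close>.\<close>

lemma fps_compositional_inverse_coeffs:
  fixes F G :: "'a :: field_char_0 fps"
  assumes GF: "G oo F = fps_X" and F: "fps_nth F 0 = 0" "fps_nth F 1 = 1"
  defines "a \<equiv> fps_nth F"
  shows "fps_nth G 3 = 2 * a 2 ^ 2 - a 3"
    and "fps_nth G 4 = - 5 * a 2 ^ 3 + 5 * a 2 * a 3 - a 4"
    and "fps_nth G 5 = 14 * a 2 ^ 4 - 21 * a 2 ^ 2 * a 3 + 6 * a 2 * a 4 + 3 * a 3 ^ 2 - a 5"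
proof -
  have eq: "(\<Sum>i=0..n. fps_nth G i * fps_nth (F ^ i) n) = (if n = 1 then 1 else 0)" for n
    using GF by (simp flip: fps_compose_nth)
  have F': "fps_nth F (Suc 0) = 1"
    using F by simp
  note ns = numeral_eq_Suc fps_mult_nth F(1) F'
  have p2: "fps_nth (F\<^sup>2) 0 = 0" "fps_nth (F\<^sup>2) 1 = 0" "fps_nth (F\<^sup>2) 2 = 1" "fps_nth (F\<^sup>2) 3 = 2 * a 2"
    "fps_nth (F\<^sup>2) 4 = 2 * a 3 + a 2 ^ 2" "fps_nth (F\<^sup>2) 5 = 2 * a 4 + 2 * a 2 * a 3"
    unfolding a_def power2_eq_square by (simp_all add: ns)
  have F3: "F ^ 3 = F\<^sup>2 * F" and F4: "F ^ 4 = F ^ 3 * F" and F5: "F ^ 5 = F ^ 4 * F"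
    by (simp_all add: eval_nat_numeral mult_ac)
  have p3: "fps_nth (F ^ 3) 0 = 0" "fps_nth (F ^ 3) 1 = 0" "fps_nth (F ^ 3) 2 = 0" "fps_nth (F ^ 3) 3 = 1"
    "fps_nth (F ^ 3) 4 = 3 * a 2" "fps_nth (F ^ 3) 5 = 3 * a 3 + 3 * a 2 ^ 2"
    unfolding F3 using p2 by (simp_all add: ns a_def)
  have p4: "fps_nth (F ^ 4) 0 = 0" "fps_nth (F ^ 4) 1 = 0" "fps_nth (F ^ 4) 2 = 0" "fps_nth (F ^ 4) 3 = 0"
    "fps_nth (F ^ 4) 4 = 1" "fps_nth (F ^ 4) 5 = 4 * a 2"
    unfolding F4 using p3 by (simp_all add: ns a_def)
  have p5: "fps_nth (F ^ 5) 5 = 1"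
    unfolding F5 using p4 by (simp add: ns a_def)
  have sums: "(\<Sum>i=0..1. h i) = h 0 + h 1" "(\<Sum>i=0..2. h i) = h 0 + h 1 + h 2"
    "(\<Sum>i=0..3. h i) = h 0 + h 1 + h 2 + h 3" "(\<Sum>i=0..4. h i) = h 0 + h 1 + h 2 + h 3 + h 4"
    "(\<Sum>i=0..5. h i) = h 0 + h 1 + h 2 + h 3 + h 4 + h 5" for h :: "nat \<Rightarrow> 'a"
    by (simp_all add: numeral_eq_Suc)
  have G1: "fps_nth G 1 = 1"
    using eq[of 1] F unfolding sums by simp
  have "a 2 + fps_nth G 2 = 0"
    using eq[of 2] G1 F p2 unfolding sums by (simp add: a_def)
  then have G2: "fps_nth G 2 = - a 2"
    by (simp add: eq_neg_iff_add_eq_0 add.commute)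
  have "a 3 + fps_nth G 2 * (2 * a 2) + fps_nth G 3 = 0"
    using eq[of 3] G1 F p2 p3 unfolding sums by (simp add: a_def)
  then show G3: "fps_nth G 3 = 2 * a 2 ^ 2 - a 3"
    unfolding G2 by algebra
  have "a 4 + fps_nth G 2 * (2 * a 3 + a 2 ^ 2) + fps_nth G 3 * (3 * a 2) + fps_nth G 4 = 0"
    using eq[of 4] G1 F p2 p3 p4 unfolding sums by (simp add: a_def)
  then show G4: "fps_nth G 4 = - 5 * a 2 ^ 3 + 5 * a 2 * a 3 - a 4"
    unfolding G2 G3 by algebra
  have "a 5 + fps_nth G 2 * (2 * a 4 + 2 * a 2 * a 3) + fps_nth G 3 * (3 * a 3 + 3 * a 2 ^ 2)
      + fps_nth G 4 * (4 * a 2) + fps_nth G 5 = 0"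
    using eq[of 5] G1 F p2 p3 p4 p5 unfolding sums by (simp add: a_def)
  then show "fps_nth G 5 = 14 * a 2 ^ 4 - 21 * a 2 ^ 2 * a 3 + 6 * a 2 * a 4 + 3 * a 3 ^ 2 - a 5"
    unfolding G2 G3 G4 by algebra
qed

lemma has_fps_expansion_uminus_arg:
  fixes f :: "complex \<Rightarrow> complex"
  assumes "f has_fps_expansion F"
  shows "(\<lambda>z. f (- z)) has_fps_expansion (F oo (- fps_X))"
  using has_fps_expansion_compose[OF assms, of uminus "- fps_X"] has_fps_expansion_minus[OF has_fps_expansion_fps_X]
  by (simp add: o_def)

text \<open>A univalent function has a holomorphic inverse on its open image, and
  \<open>inv_into\<close> agrees with it there. The composite is the identity near 0, so uniqueness
  of power series applies.\<close>

lemma fps_expansion_inv_into_compose: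
  assumes f: "f holomorphic_on unit_disc" "inj_on f unit_disc" "f 0 = 0"
    and F: "f has_fps_expansion F"
  shows "fps_expansion (inv_into unit_disc f) 0 oo F = fps_X"
proof -
  let ?g = "inv_into unit_disc f"
  obtain g where g: "g holomorphic_on f ` unit_disc" "\<And>z. z \<in> unit_disc \<Longrightarrow> g (f z) = z"
    using holomorphic_has_inverse[OF f(1) open_ball f(2)] by metis
  have "?g y = g y" if "y \<in> f ` unit_disc" for y
    using that g(2) f(2) by (metis f_inv_into_f inv_into_into)
  then have "?g holomorphic_on f ` unit_disc"
    using g(1) holomorphic_transform by metis
  moreover have "open (f ` unit_disc)"
    using open_mapping_thm3[OF f(1) open_ball f(2)] .
  moreover have "0 \<in> f ` unit_disc"
    using f(3) by force
  ultimately have "?g has_fps_expansion fps_expansion ?g 0"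
    by blast
  moreover have "fps_nth F 0 = 0"
    using F f(3) by (simp add: fps_nth_fps_expansion)
  ultimately have comp: "(?g \<circ> f) has_fps_expansion (fps_expansion ?g 0 oo F)"
    using F by (intro has_fps_expansion_compose)
  have "\<forall>\<^sub>F z in nhds 0. z \<in> unit_disc"
    by (rule eventually_nhds_in_open) auto
  then have ev: "\<forall>\<^sub>F z in nhds 0. (?g \<circ> f) z = z"
    by eventually_elim (use f(2) in simp)
  have "(\<lambda>z. z) has_fps_expansion (fps_expansion ?g 0 oo F)"
    using comp unfolding has_fps_expansion_cong[OF ev refl] .
  then show ?thesis
    using fps_expansion_unique_complex has_fps_expansion_fps_X by blast
qed

text \<open>The quotient equation, cleared of its denominator, becomes an identity of power series.
  It determines \<open>a 2\<close> to \<open>a 5\<close> from the coefficients of \<open>W\<close>,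
  and the inversion formulas then express the determinant.\<close>

lemma H23_inverse_eq:
  assumes f: "f \<in> schlicht_class" and w: "w holomorphic_on unit_disc" "w 0 = 0" "w has_fps_expansion W"
    and sq: "\<And>z. z \<in> unit_disc \<Longrightarrow> sym_quotient f z = exp (w z)"
  defines "c \<equiv> fps_nth W"
  shows "H23_inverse f = - 13/2304 * c 1 ^ 6 - 5/64 * (c 1 ^ 4 * c 2) + 7/96 * (c 1 ^ 3 * c 3)
    - 9/64 * ((c 1)\<^sup>2 * (c 2)\<^sup>2) - 1/16 * ((c 1)\<^sup>2 * c 4) + 3/16 * (c 1 * c 2 * c 3)
    - 1/4 * c 2 ^ 3 + 1/8 * (c 2 * c 4) - 1/16 * (c 3)\<^sup>2"
proof -
  have hol: "f holomorphic_on unit_disc" and inj: "inj_on f unit_disc" and f0: "f 0 = 0" and d0: "deriv f 0 = 1"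
    using f by (auto simp: schlicht_class_def)
  define F where "F = fps_expansion f 0"
  have F: "f has_fps_expansion F"
    unfolding F_def using hol by (intro has_fps_expansion_fps_expansion[of unit_disc]) auto
  have F0: "fps_nth F 0 = 0" and F1: "fps_nth F 1 = 1"
    using fps_nth_fps_expansion[OF F] f0 d0 by simp_all
  have W0: "c 0 = 0"
    using w(2,3) by (simp add: c_def fps_nth_fps_expansion)
  define E where "E = fps_exp 1 oo W"
  have "(exp \<circ> w) has_fps_expansion E"
    unfolding E_def using w(3) W0 by (intro has_fps_expansion_compose has_fps_expansion_exp1) (auto simp: c_def)
  then have comp: "(\<lambda>z. (f z - f (- z)) * (exp \<circ> w) z) has_fps_expansion (F - (F oo (- fps_X))) * E"
    by (intro fps_expansion_intros F has_fps_expansion_uminus_arg)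
  have "\<forall>\<^sub>F z in nhds 0. z \<in> unit_disc"
    by (rule eventually_nhds_in_open) auto
  \<comment> \<open>Away from 0, injectivity makes the denominator nonzero; at 0 both sides
    vanish.\<close>
  then have ev: "\<forall>\<^sub>F z in nhds 0. (f z - f (- z)) * (exp \<circ> w) z = 2 * (z * deriv f z)"
  proof eventually_elim
    case (elim z)
    show ?case
    proof (cases "z = 0")
      case False
      then have "f z \<noteq> f (- z)"
        using inj_onD[OF inj, of z "- z"] elim by (auto simp: eq_neg_iff_add_eq_0)
      then show ?thesis
        using sq[OF elim] False by (simp add: sym_quotient_def field_simps)
    qed (use f0 in simp)
  qed
  have "(\<lambda>z. 2 * (z * deriv f z)) has_fps_expansion (F - (F oo (- fps_X))) * E"
    using comp unfolding has_fps_expansion_cong[OF ev refl] .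
  moreover have "(\<lambda>z. 2 * (z * deriv f z)) has_fps_expansion fps_const 2 * (fps_X * fps_deriv F)"
    by (intro fps_expansion_intros F)
  ultimately have FE: "fps_const 2 * (fps_X * fps_deriv F) = (F - (F oo (- fps_X))) * E"
    using fps_expansion_unique_complex by blast
  have E0: "fps_nth E 0 = 1"
    by (simp add: E_def)
  \<comment> \<open>This differential equation yields the coefficients of
    \<open>exp \<circ> w\<close> recursively.\<close>
  have dE: "fps_deriv E = E * fps_deriv W"
    using W0 by (simp add: E_def c_def fps_compose_deriv)
  have E1: "fps_nth E 1 = c 1"
    using arg_cong[OF dE, of "\<lambda>A. fps_nth A 0"] E0 by (simp add: c_def)
  have E1': "fps_nth E (Suc 0) = c (Suc 0)"
    using E1 by simp
  have "2 * fps_nth E 2 = 2 * c 2 + c 1 * c 1"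
    using arg_cong[OF dE, of "\<lambda>A. fps_nth A 1"] E0 E1'
    by (simp add: c_def numeral_eq_Suc fps_mult_nth)
  then have E2: "fps_nth E 2 = c 2 + c 1 ^ 2 / 2"
    by (simp add: field_simps power2_eq_square)
  have "3 * fps_nth E 3 = 3 * c 3 + c 1 * (2 * c 2) + fps_nth E 2 * c 1"
    using arg_cong[OF dE, of "\<lambda>A. fps_nth A 2"] E0 E1'
    by (simp add: c_def numeral_eq_Suc fps_mult_nth)
  also have "\<dots> = 3 * (c 3 + c 1 * c 2 + c 1 ^ 3 / 6)"
    unfolding E2 by (simp add: field_simps power2_eq_square eval_nat_numeral)
  finally have E3: "fps_nth E 3 = c 3 + c 1 * c 2 + c 1 ^ 3 / 6"
    by (simp only: mult_cancel_left) simp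
  have "4 * fps_nth E 4 = 4 * c 4 + c 1 * (3 * c 3) + fps_nth E 2 * (2 * c 2) + fps_nth E 3 * c 1"
    using arg_cong[OF dE, of "\<lambda>A. fps_nth A 3"] E0 E1'
    by (simp add: c_def numeral_eq_Suc fps_mult_nth)
  also have "\<dots> = 4 * (c 4 + c 1 * c 3 + c 2 ^ 2 / 2 + c 1 ^ 2 * c 2 / 2 + c 1 ^ 4 / 24)"
    unfolding E2 E3 by (simp add: field_simps power2_eq_square eval_nat_numeral)
  finally have E4: "fps_nth E 4 = c 4 + c 1 * c 3 + c 2 ^ 2 / 2 + c 1 ^ 2 * c 2 / 2 + c 1 ^ 4 / 24"
    by (simp only: mult_cancel_left) simp
  define a where "a = fps_nth F"
  \<comment> \<open>Only odd \<open>i\<close> contribute. For odd \<open>n\<close> the summand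
    \<open>i = n\<close> is \<open>2 * a n\<close>, so the factor of \<open>a n\<close> drops to
    \<open>2 n - 2\<close> once it is moved to the left: 4 for \<open>a 3\<close> and 8 for
    \<open>a 5\<close>.\<close>
  have FEn: "2 * of_nat n * a n = (\<Sum>i=0..n. (1 - (-1) ^ i) * a i * fps_nth E (n - i))" for n
  proof -
    have "2 * of_nat n * a n = fps_nth (fps_const 2 * (fps_X * fps_deriv F)) n"
      by (cases n) (simp_all add: a_def)
    also have "\<dots> = (\<Sum>i=0..n. fps_nth (F - (F oo (- fps_X))) i * fps_nth E (n - i))"
      unfolding FE by (rule fps_mult_nth)
    also have "\<dots> = (\<Sum>i=0..n. (1 - (-1) ^ i) * a i * fps_nth E (n - i))"
      by (simp add: fps_compose_uminus' a_def left_diff_distrib)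
    finally show ?thesis .
  qed
  have a01: "a 0 = 0" "a (Suc 0) = 1"
    using F0 F1 by (simp_all add: a_def)
  note ns = numeral_eq_Suc E0 E1' a01
  have "4 * a 2 = 2 * c 1"
    using FEn[of 2] by (simp add: ns)
  then have a2: "a 2 = c 1 / 2"
    by (simp add: field_simps)
  have "4 * a 3 = 2 * fps_nth E 2"
    using FEn[of 3] by (simp add: ns)
  also have "\<dots> = 4 * (c 2 / 2 + c 1 ^ 2 / 4)"
    unfolding E2 by (simp add: field_simps power2_eq_square eval_nat_numeral)
  finally have a3: "a 3 = c 2 / 2 + c 1 ^ 2 / 4"
    by (simp only: mult_cancel_left) simp
  have "8 * a 4 = 2 * fps_nth E 3 + 2 * a 3 * c 1"
    using FEn[of 4] by (simp add: ns)
  also have "\<dots> = 8 * (c 3 / 4 + 3 * c 1 * c 2 / 8 + 5 * c 1 ^ 3 / 48)"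
    unfolding E3 a3 by (simp add: field_simps power2_eq_square eval_nat_numeral)
  finally have a4: "a 4 = c 3 / 4 + 3 * c 1 * c 2 / 8 + 5 * c 1 ^ 3 / 48"
    by (simp only: mult_cancel_left) simp
  have "8 * a 5 = 2 * fps_nth E 4 + 2 * a 3 * fps_nth E 2"
    using FEn[of 5] by (simp add: ns)
  also have "\<dots> = 8 * (c 4 / 4 + c 1 * c 3 / 4 + c 2 ^ 2 / 4 + c 1 ^ 2 * c 2 / 4 + c 1 ^ 4 / 24)"
    unfolding E4 E2 a3 by (simp add: field_simps power2_eq_square eval_nat_numeral)
  finally have a5: "a 5 = c 4 / 4 + c 1 * c 3 / 4 + c 2 ^ 2 / 4 + c 1 ^ 2 * c 2 / 4 + c 1 ^ 4 / 24"
    by (simp only: mult_cancel_left) simp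
  have "H23_inverse f = (2 * a 2 ^ 2 - a 3) *
      (14 * a 2 ^ 4 - 21 * a 2 ^ 2 * a 3 + 6 * a 2 * a 4 + 3 * a 3 ^ 2 - a 5) -
      (- 5 * a 2 ^ 3 + 5 * a 2 * a 3 - a 4)\<^sup>2"
    unfolding H23_inverse_def inverse_coeff_def a_def
    using fps_compositional_inverse_coeffs[OF fps_expansion_inv_into_compose[OF hol inj f0 F] F0 F1] by simp
  also have "\<dots> = - 13/2304 * c 1 ^ 6 - 5/64 * (c 1 ^ 4 * c 2) + 7/96 * (c 1 ^ 3 * c 3)
      - 9/64 * ((c 1)\<^sup>2 * (c 2)\<^sup>2) - 1/16 * ((c 1)\<^sup>2 * c 4) + 3/16 * (c 1 * c 2 * c 3)
      - 1/4 * c 2 ^ 3 + 1/8 * (c 2 * c 4) - 1/16 * (c 3)\<^sup>2"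
    unfolding a2 a3 a4 a5 by (simp add: field_simps power2_eq_square eval_nat_numeral)
  finally show ?thesis .
qed

section \<open>The upper bound\<close>

lemma norm_H23_inverse_le:
  assumes "f \<in> S_star_Se"
  shows "norm (H23_inverse f) \<le> 1 / 4"
proof -
  obtain w where f: "f \<in> schlicht_class" and w: "w holomorphic_on unit_disc" "w 0 = 0"
    and im: "w ` unit_disc \<subseteq> unit_disc"
    and sq: "\<And>z. z \<in> unit_disc \<Longrightarrow> sym_quotient f z = exp (w z)"
    using assms by (auto simp: S_star_Se_def subordinate_def)
  define W where "W = fps_expansion w 0"
  have W: "w has_fps_expansion W"
    unfolding W_def using w(1) by (intro has_fps_expansion_fps_expansion[of unit_disc]) auto
  have W0: "fps_nth W 0 = 0"
    using w(2) W by (simp add: fps_nth_fps_expansion)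
  have le: "norm (w z) \<le> 1" if "norm z < 1" for z
    using im that by (force simp: image_subset_iff)
  define t s u v where "t = norm (fps_nth W 1)" and "s = norm (fps_nth W 2)"
    and "u = norm (fps_nth W 3)" and "v = norm (fps_nth W 4)"
  note defs = t_def s_def u_def v_def
  \<comment> \<open>Every coefficient and every \<open>c\<^sub>i\<close> in the polynomial is
    replaced by its modulus.\<close>
  have "norm (H23_inverse f) \<le> 13/2304 * t^6 + 5/64 * (t^4 * s) + 7/96 * (t^3 * u)
      + 9/64 * (t\<^sup>2 * s\<^sup>2) + 1/16 * (t\<^sup>2 * v) + 3/16 * (t * s * u) + 1/4 * s^3 + 1/8 * (s * v) + 1/16 * u\<^sup>2"
    unfolding H23_inverse_eq[OF f w W sq, simplified]
    by (intro order_trans[OF norm_triangle_ineq4] order_trans[OF norm_triangle_ineq] add_mono)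
       (simp_all add: norm_mult norm_power defs)
  also have "\<dots> \<le> 1 / 4"
    using bounded_fps_nth_ineqs[OF w(1) W W0 le]
    by (intro hankel_majorant_le) (simp_all add: defs)
  finally show ?thesis .
qed

section \<open>Sharpness: construction and univalence of the extremal function\<close>

text \<open>
  A power series for $\frac{1}{2} \int_0^u (e^s - 1) / s \, ds$. The term for $k = 0$ vanishes
  because of the division by zero.
\<close>

definition half_Ein :: "complex \<Rightarrow> complex" where
  "half_Ein u = (\<Sum>k. 1 / (2 * of_nat k * fact k) * u ^ k)"

lemma summable_half_Ein: "summable (\<lambda>k. norm (1 / (2 * of_nat k * fact k) * u ^ k :: complex))"
proof (rule summable_comparison_test)
  show "summable (\<lambda>k. norm u ^ k /\<^sub>R fact k)"
    by (rule summable_exp_generic)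
  have "1 / (2 * real k * fact k) \<le> 1 / fact k" for k
  proof -
    \<comment> \<open>For \<open>k = 0\<close> the left side is 0 by division by zero.\<close>
    have "1 / (2 * real k) \<le> 1"
      by (cases k) auto
    from mult_right_mono[OF this, of "1 / fact k"] show ?thesis
      by simp
  qed
  then have "1 / (2 * real k * fact k) * norm u ^ k \<le> 1 / fact k * norm u ^ k" for k
    by (intro mult_right_mono) auto
  moreover have "norm (1 / (2 * of_nat k * fact k) * u ^ k :: complex) = 1 / (2 * real k * fact k) * norm u ^ k" for k
    by (simp add: norm_mult norm_divide norm_power)
  moreover have "norm u ^ k /\<^sub>R fact k = 1 / fact k * norm u ^ k" for k
    by (simp add: divide_inverse)
  ultimately show "\<exists>N. \<forall>k\<ge>N. norm (norm (1 / (2 * of_nat k * fact k) * u ^ k :: complex)) \<le> norm u ^ k /\<^sub>R fact k"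
    unfolding real_norm_def abs_norm_cancel by (simp only:) blast
qed

lemma half_Ein_0 [simp]: "half_Ein 0 = 0"
proof -
  have "half_Ein 0 = (\<Sum>k. 0)"
    unfolding half_Ein_def by (rule suminf_cong) (auto simp: power_0_left)
  then show ?thesis by simp
qed

text \<open>Termwise differentiation turns \<open>2 u\<close> times the derivative into the
  exponential series without its constant term. The product form also covers \<open>u = 0\<close>,
  where the quotient \<open>(exp u - 1) / (2 * u)\<close> would be 0 instead of 1/2.\<close>

lemma has_field_derivative_half_Ein:
  obtains d where "(half_Ein has_field_derivative d) (at u)" "2 * u * d = exp u - 1"
proof
  let ?a = "\<lambda>k. 1 / (2 * of_nat k * fact k) :: complex"
  have summable: "summable (\<lambda>k. ?a k * z ^ k)" for z
    using summable_half_Ein by (rule summable_norm_cancel)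
  show "(half_Ein has_field_derivative (\<Sum>k. diffs ?a k * u ^ k)) (at u)"
    unfolding half_Ein_def using summable by (rule termdiffs_strong_converges_everywhere)
  have "(\<lambda>k. diffs ?a k * u ^ k) sums (\<Sum>k. diffs ?a k * u ^ k)"
    by (intro summable_sums termdiff_converges_all summable)
  from sums_mult[OF this, of "2 * u"]
  have "(\<lambda>k. 2 * u * (diffs ?a k * u ^ k)) sums (2 * u * (\<Sum>k. diffs ?a k * u ^ k))" .
  moreover have "2 * u * (diffs ?a k * u ^ k) = u ^ Suc k /\<^sub>R fact (Suc k)" for k
  proof -
    have "of_nat (Suc k) \<noteq> (0 :: complex)"
      by (simp del: of_nat_Suc)
    then have d: "diffs ?a k = 1 / (2 * fact (Suc k))"
      by (simp add: diffs_def del: of_nat_Suc fact_Suc)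
    show ?thesis
      unfolding d by (simp add: scaleR_conv_of_real field_simps del: fact_Suc)
  qed
  ultimately have "(\<lambda>k. u ^ Suc k /\<^sub>R fact (Suc k)) sums (2 * u * (\<Sum>k. diffs ?a k * u ^ k))"
    by (simp only:)
  then have "(\<lambda>k. u ^ k /\<^sub>R fact k) sums (2 * u * (\<Sum>k. diffs ?a k * u ^ k) + 1)"
    by (subst (asm) sums_Suc_iff) simp
  moreover have "(\<lambda>k. u ^ k /\<^sub>R fact k) sums exp u"
    by (rule exp_converges)
  ultimately have "2 * u * (\<Sum>k. diffs ?a k * u ^ k) + 1 = exp u"
    by (rule sums_unique2)
  then show "2 * u * (\<Sum>k. diffs ?a k * u ^ k) = exp u - 1"
    by (simp add: algebra_simps)
qed

text \<open>For indices \<open>k \<ge> 3\<close> the factor \<open>1 / (2 k)\<close> is at most 1/6,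
  and the sum of \<open>1 / k!\<close> over these indices is \<open>e - 5/2\<close>.\<close>

lemma norm_half_Ein_tail_le:
  assumes "norm u \<le> 1"
  shows "norm (half_Ein u - (u / 2 + u\<^sup>2 / 8)) \<le> (exp 1 - 5 / 2) / 6"
proof -
  let ?a = "\<lambda>k. 1 / (2 * of_nat k * fact k) :: complex"
  have "summable (\<lambda>k. ?a k * u ^ k)"
    using summable_half_Ein by (rule summable_norm_cancel)
  from suminf_split_initial_segment[OF this, of 3]
  have "half_Ein u - (u / 2 + u\<^sup>2 / 8) = (\<Sum>k. ?a (k + 3) * u ^ (k + 3))"
    by (simp add: half_Ein_def numeral_eq_Suc)
  moreover have "norm (\<Sum>k. ?a (k + 3) * u ^ (k + 3)) \<le> (\<Sum>k. 1 / 6 * (1 ^ (k + 3) /\<^sub>R fact (k + 3) :: real))"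
  proof (rule norm_suminf_le)
    show "summable (\<lambda>k. 1 / 6 * (1 ^ (k + 3) /\<^sub>R fact (k + 3) :: real))"
      by (intro summable_mult summable_ignore_initial_segment summable_exp_generic)
    fix k
    have "norm (u ^ (k + 3)) \<le> 1"
      using assms by (simp add: norm_power power_le_one)
    moreover have "norm (?a (k + 3)) \<le> 1 / 6 * (1 / fact (k + 3))"
    proof -
      have "norm (?a (k + 3)) = 1 / (2 * real (k + 3)) * (1 / fact (k + 3))"
        by (simp add: norm_divide norm_mult del: of_nat_add)
      moreover have "1 / (2 * real (k + 3)) \<le> 1 / 6"
        by (simp add: field_simps)
      ultimately show ?thesis
        by (simp only:) (rule mult_right_mono, auto)
    qed
    ultimately have "norm (?a (k + 3)) * norm (u ^ (k + 3)) \<le> 1 / 6 * (1 / fact (k + 3)) * 1"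
      by (intro mult_mono) simp_all
    then show "norm (?a (k + 3) * u ^ (k + 3)) \<le> 1 / 6 * (1 ^ (k + 3) /\<^sub>R fact (k + 3) :: real)"
      by (simp only: norm_mult power_one real_scaleR_def mult_1_right inverse_eq_divide)
  qed
  moreover have "(\<Sum>k. 1 / 6 * (1 ^ (k + 3) /\<^sub>R fact (k + 3) :: real)) = (exp 1 - 5 / 2) / 6"
  proof -
    have "(\<Sum>k. 1 ^ (k + 3) /\<^sub>R fact (k + 3)) = (\<Sum>k. 1 ^ k /\<^sub>R fact k) - (\<Sum>k<3. 1 ^ k /\<^sub>R fact k :: real)"
      by (rule suminf_minus_initial_segment[OF summable_exp_generic])
    also have "(\<Sum>k. 1 ^ k /\<^sub>R fact k) = exp (1 :: real)"
      using exp_converges[of "1 :: real"] by (rule sums_unique[symmetric])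
    also have "(\<Sum>k<3. 1 ^ k /\<^sub>R fact k) = (5 / 2 :: real)"
      by (simp add: numeral_eq_Suc)
    finally have "(\<Sum>k. 1 ^ (k + 3) /\<^sub>R fact (k + 3)) = (exp 1 - 5 / 2 :: real)" .
    moreover have "summable (\<lambda>k. 1 ^ (k + 3) /\<^sub>R fact (k + 3) :: real)"
      by (intro summable_ignore_initial_segment summable_exp_generic)
    ultimately show ?thesis
      by (subst suminf_mult) auto
  qed
  ultimately show ?thesis by simp
qed

lemma abs_Im_add_half_Ein_less:
  assumes "norm u < 1"
  shows "\<bar>Im (u + half_Ein u)\<bar> < pi / 2"
proof -
  define x y where "x = Re u" and "y = Im u"
  define R where "R = half_Ein u - (u / 2 + u\<^sup>2 / 8)"
  have "\<bar>Im R\<bar> \<le> norm R"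
    by (rule abs_Im_le_cmod)
  also have "\<dots> \<le> (exp 1 - 5 / 2) / 6"
    unfolding R_def using assms by (intro norm_half_Ein_tail_le) simp
  also have "\<dots> < 4 / 100"
    using e_less_272 by simp
  finally have R: "\<bar>Im R\<bar> < 4 / 100" .
  have "(norm u)\<^sup>2 < 1"
    using assms by (simp add: power_less_one_iff abs_square_less_1)
  then have xy: "x\<^sup>2 + y\<^sup>2 < 1"
    by (simp add: x_def y_def cmod_power2)
  \<comment> \<open>The weights are chosen so that both \<open>x^2\<close> and \<open>y^2\<close>
    receive about 3/4 in total, to be absorbed by \<open>x^2 + y^2 < 1\<close>. The result is below
    1.561, just under \<open>pi / 2\<close>.\<close>
  have am: "3 / 2 * \<bar>y\<bar> \<le> 3 / 4 * (1 + y\<^sup>2)" "1 / 4 * (\<bar>x\<bar> * \<bar>y\<bar>) \<le> 3 / 4 * x\<^sup>2 + 1 / 48 * y\<^sup>2"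
    using sum_squares_ge_zero[of "\<bar>y\<bar> - 1" 0] sum_squares_ge_zero[of "6 * \<bar>x\<bar> - \<bar>y\<bar>" 0]
    by (simp_all add: power2_eq_square algebra_simps flip: abs_mult)
  have "Im (u + half_Ein u) = 3 / 2 * y + 1 / 4 * (x * y) + Im R"
    by (simp add: R_def x_def y_def power2_eq_square)
  then have "\<bar>Im (u + half_Ein u)\<bar> \<le> 3 / 2 * \<bar>y\<bar> + 1 / 4 * (\<bar>x\<bar> * \<bar>y\<bar>) + \<bar>Im R\<bar>"
    by (simp flip: abs_mult)
  also have "\<dots> < 3 / 4 + (3 / 4 + 1 / 48) + 4 / 100"
    using am R xy zero_le_power2[of x] zero_le_power2[of y] by argo
  also have "\<dots> < pi / 2"
    using pi_approx by simp
  finally show ?thesis .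
qed

text \<open>The Noshiro-Warschawski criterion.\<close>

lemma inj_on_if_Re_deriv_pos:
  assumes "convex A" and d: "\<And>z. z \<in> A \<Longrightarrow> (f has_field_derivative f' z) (at z)"
    and pos: "\<And>z. z \<in> A \<Longrightarrow> 0 < Re (f' z)"
  shows "inj_on f A"
proof (rule inj_onI, rule ccontr)
  fix a b
  assume ab: "a \<in> A" "b \<in> A" "f a = f b" "a \<noteq> b"
  have sub: "closed_segment a b \<subseteq> A"
    using ab assms(1) by (simp add: closed_segment_subset)
  \<comment> \<open>Dividing \<open>f\<close> by the constant \<open>b - a\<close> cancels the
    direction factor in the mean value theorem, leaving \<open>Re (f' u)\<close>.\<close>
  have "\<exists>u. u \<in> closed_segment a b \<and>
      Re (f b / (b - a)) - Re (f a / (b - a)) = Re (f' u / (b - a) * (b - a))"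
    using sub by (intro complex_mvt_line DERIV_cdivide d) auto
  then obtain u where "u \<in> closed_segment a b" "Re (f' u) = 0"
    using ab by auto
  then show False
    using sub pos[of u] by auto
qed

lemma norm_H23_inverse_attained: "\<exists>f\<in>S_star_Se. norm (H23_inverse f) = 1 / 4"
proof
  \<comment> \<open>For odd \<open>f\<close> the quotient is \<open>z f'(z) / f(z)\<close>. Setting
    it equal to \<open>exp (z^2)\<close> and integrating the logarithmic derivative of
    \<open>f(z) / z\<close> gives this function.\<close>
  define f where "f = (\<lambda>z. z * exp (half_Ein (z\<^sup>2)))"
  have f': "(f has_field_derivative exp (z\<^sup>2 + half_Ein (z\<^sup>2))) (at z)" for z
  proof -
    obtain d where d: "(half_Ein has_field_derivative d) (at (z\<^sup>2))" "2 * z\<^sup>2 * d = exp (z\<^sup>2) - 1"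
      using has_field_derivative_half_Ein .
    have "((\<lambda>z. half_Ein (z\<^sup>2)) has_field_derivative d * (2 * z)) (at z)"
      by (rule DERIV_chain2[where f = half_Ein and g = "\<lambda>z. z\<^sup>2", OF d(1)]) (auto intro!: derivative_eq_intros)
    then have "(f has_field_derivative
        exp (half_Ein (z\<^sup>2)) + z * (exp (half_Ein (z\<^sup>2)) * (d * (2 * z)))) (at z)"
      unfolding f_def by (auto intro!: derivative_eq_intros)
    moreover have "exp (half_Ein (z\<^sup>2)) + z * (exp (half_Ein (z\<^sup>2)) * (d * (2 * z)))
        = exp (half_Ein (z\<^sup>2)) * (1 + 2 * z\<^sup>2 * d)"
      by (simp add: algebra_simps power2_eq_square)
    ultimately show ?thesis
      unfolding d(2) by (simp add: exp_add mult.commute)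
  qed
  have hol: "f holomorphic_on unit_disc"
    using f' by (auto simp: holomorphic_on_open)
  have "inj_on f unit_disc"
  proof (rule inj_on_if_Re_deriv_pos[OF _ f'])
    fix z :: complex
    assume "z \<in> unit_disc"
    then have "norm (z\<^sup>2) < 1"
      by (simp add: norm_power power_less_one_iff abs_square_less_1)
    then have "\<bar>Im (z\<^sup>2 + half_Ein (z\<^sup>2))\<bar> < pi / 2"
      by (rule abs_Im_add_half_Ein_less)
    then show "0 < Re (exp (z\<^sup>2 + half_Ein (z\<^sup>2)))"
      unfolding Re_exp abs_less_iff by (intro mult_pos_pos cos_gt_zero_pi) auto
  qed simp
  then have f: "f \<in> schlicht_class"
    using hol DERIV_imp_deriv[OF f', of 0] by (simp add: schlicht_class_def f_def)
  have sq: "sym_quotient f z = exp (z\<^sup>2)" for z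
  proof (cases "z = 0")
    case False
    then show ?thesis
      by (simp add: sym_quotient_def DERIV_imp_deriv[OF f'] exp_add) (simp add: f_def)
  qed (simp add: sym_quotient_def)
  have "sym_quotient f \<prec>\<^sub>D exp"
    unfolding subordinate_def
  proof (intro conjI exI[of _ "\<lambda>z. z\<^sup>2"] ballI)
    show "sym_quotient f holomorphic_on unit_disc"
      unfolding sq[abs_def] by (intro holomorphic_intros)
    show "(\<lambda>z::complex. z\<^sup>2) ` unit_disc \<subseteq> unit_disc"
      by (auto simp: norm_power power_less_one_iff abs_square_less_1)
  qed (auto simp: sq intro!: holomorphic_intros)
  with f show "f \<in> S_star_Se"
    by (simp add: S_star_Se_def)
  \<comment> \<open>With \<open>w(z) = z^2\<close> only \<open>c\<^sub>2 = 1\<close> is nonzero, so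
    just the cubic term in \<open>c\<^sub>2\<close> survives.\<close>
  have "H23_inverse f = - 1 / 4"
    using H23_inverse_eq[OF f _ _ has_fps_expansion_fps_X_power[of 2] sq]
    by (simp add: holomorphic_intros)
  then show "norm (H23_inverse f) = 1 / 4"
    by (simp add: norm_divide)
qed

theorem theorem2p8:
  shows "(\<forall>f\<in>S_star_Se. norm (H23_inverse f) \<le> 1 / 4) \<and>
         (\<exists>f\<in>S_star_Se. norm (H23_inverse f) = 1 / 4)"
  using norm_H23_inverse_le norm_H23_inverse_attained by blast

end
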